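(* Let $\mathcal H$ be a real Hilbert space, $\Phi:\mathcal H\to\mathbb R$ twice continuously differentiable, $\alpha\ge 0$, $\beta>0$, $t_0>0$ and $(x_0,\dot x_0)\in\mathcal H\times\mathcal H$. For a function $x:[t_0,+\infty[\to\mathcal H$, the following statements are equivalent: (1) $x$ is a solution of the second-order differential equation $$\ddot x(t)+\frac{\alpha}{t}\dot x(t)+\beta\nabla^2\Phi(x(t))\dot x(t)+\nabla\Phi(x(t))=0$$ with initial conditions $x(t_0)=x_0$, $\dot x(t_0)=\dot x_0$. (2) There is a function $y:[t_0,+\infty[\to\mathcal H$ such that $(x,y):[t_0,+\infty[\to\mathcal H\times\mathcal H$ is a solution of the first-order system $$\left\{\begin{array}{rcl}\dot x(t)+\beta\nabla\Phi(x(t))-\left(\frac1\beta-\frac{\alpha}{t}\right)x(t)+\frac1\beta y(t)&=&0\\[2mm] \dot y(t)-\left(\frac1\beta-\frac{\alpha}{t}+\frac{\alpha\beta}{t^2}\right)x(t)+\frac1\beta y(t)&=&0\end{array}\right.$$ with initial conditions $x(t_0)=x_0$, $y(t_0)=-\beta\big(\dot x_0+\beta\nabla\Phi(x_0)\big)+\left(1-\frac{\beta\alpha}{t_0}\right)x_0$.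
   Context: Solutions are classical: a solution of the second-order equation is a twice continuously differentiable function, and a solution of the first-order system is a continuously differentiable pair, satisfying the equations for all $t\ge t_0$. *)

theory Defs
  imports "HOL-Analysis.Analysis"
begin

text \<open>The Frechet derivatives are taken with values in the spaces of bounded linear maps with
  the operator norm. Continuity of \<open>f'\<close> follows from its differentiability.\<close>

definition twice_continuously_differentiable ::
    "('a::real_normed_vector \<Rightarrow> 'b::real_normed_vector) \<Rightarrow> bool" where
  "twice_continuously_differentiable f \<longleftrightarrow>
     (\<exists>(f' :: 'a \<Rightarrow> 'a \<Rightarrow>\<^sub>L 'b) (f'' :: 'a \<Rightarrow> 'a \<Rightarrow>\<^sub>L ('a \<Rightarrow>\<^sub>L 'b)).
        (\<forall>x. (f has_derivative blinfun_apply (f' x)) (at x)) \<and>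
        (\<forall>x. (f' has_derivative blinfun_apply (f'' x)) (at x)) \<and>
        continuous_on UNIV f'')"

definition gradient :: "('a::real_inner \<Rightarrow> real) \<Rightarrow> 'a \<Rightarrow> 'a" where
  "gradient f x = (THE D. GDERIV f x :> D)"

definition hessian :: "('a::real_inner \<Rightarrow> real) \<Rightarrow> 'a \<Rightarrow> 'a \<Rightarrow> 'a" where
  "hessian f x = frechet_derivative (gradient f) (at x)"

lemma gradient_eqI:
  assumes "GDERIV f x :> D"
  shows "gradient f x = D"
proof -
  have "E = D" if "GDERIV f x :> E" for E
  proof -
    have "(\<lambda>h. inner h E) = (\<lambda>h. inner h D)"
      using that assms unfolding gderiv_def by (rule has_derivative_unique)
    then have "inner (E - D) E = inner (E - D) D" by meson
    then have "inner (E - D) (E - D) = 0" by (simp add: inner_diff_right)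
    then show "E = D" by simp
  qed
  with assms show ?thesis unfolding gradient_def by (intro the_equality)
qed

text \<open>A function on a set \<open>S\<close> is represented by a total function of which only the values on
  \<open>S\<close> matter; at an endpoint of an interval the derivative is the one-sided one.\<close>

definition continuously_differentiable_with ::
    "(real \<Rightarrow> 'a::real_normed_vector) \<Rightarrow> (real \<Rightarrow> 'a) \<Rightarrow> real set \<Rightarrow> bool" where
  "continuously_differentiable_with x x' S \<longleftrightarrow>
     (\<forall>t\<in>S. (x has_vector_derivative x' t) (at t within S)) \<and> continuous_on S x'"

definition second_order_solution ::
    "('a::real_inner \<Rightarrow> real) \<Rightarrow> real \<Rightarrow> real \<Rightarrow> real \<Rightarrow> 'a \<Rightarrow> 'a \<Rightarrow> (real \<Rightarrow> 'a) \<Rightarrow> bool" where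
  "second_order_solution \<Phi> \<alpha> \<beta> t0 x0 v0 x \<longleftrightarrow>
     (\<exists>x' x''.
        continuously_differentiable_with x x' {t0..} \<and>
        continuously_differentiable_with x' x'' {t0..} \<and>
        (\<forall>t\<ge>t0. x'' t + (\<alpha> / t) *\<^sub>R x' t + \<beta> *\<^sub>R hessian \<Phi> (x t) (x' t) + gradient \<Phi> (x t) = 0) \<and>
        x t0 = x0 \<and> x' t0 = v0)"

definition first_order_solution ::
    "('a::real_inner \<Rightarrow> real) \<Rightarrow> real \<Rightarrow> real \<Rightarrow> real \<Rightarrow> 'a \<Rightarrow> 'a \<Rightarrow>
     (real \<Rightarrow> 'a) \<Rightarrow> (real \<Rightarrow> 'a) \<Rightarrow> bool" where
  "first_order_solution \<Phi> \<alpha> \<beta> t0 x0 y0 x y \<longleftrightarrow>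
     (\<exists>x' y'.
        continuously_differentiable_with x x' {t0..} \<and>
        continuously_differentiable_with y y' {t0..} \<and>
        (\<forall>t\<ge>t0. x' t + \<beta> *\<^sub>R gradient \<Phi> (x t) - (1 / \<beta> - \<alpha> / t) *\<^sub>R x t + (1 / \<beta>) *\<^sub>R y t = 0 \<and>
                y' t - (1 / \<beta> - \<alpha> / t + \<alpha> * \<beta> / t\<^sup>2) *\<^sub>R x t + (1 / \<beta>) *\<^sub>R y t = 0) \<and>
        x t0 = x0 \<and> y t0 = y0)"

end

theory Submission imports Defs begin

text \<open>Since
  \<open>\<nabla>\<^sup>2\<Phi>(x)x'\<close> is the time derivative of \<open>\<nabla>\<Phi>(x)\<close>, the first equation of the system, solved for
  \<open>y\<close>, gives \<open>y = -\<beta>(x' + \<beta>\<nabla>\<Phi>(x)) + (1 - \<alpha>\<beta>/t)x\<close>, and differentiating it turns the second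
  equation into the second-order equation. The gradient is differentiable because it is the Frechet
  derivative composed with the bounded linear Riesz isomorphism.\<close>

section \<open>Riesz representation in a real Hilbert space\<close>

text \<open>The representing vector minimises the functional \<open>\<parallel>x\<parallel>\<^sup>2/2 - f x\<close>; minimising
  sequences are Cauchy by the parallelogram identity.\<close>

lemma riesz_representation:
  fixes f :: "'a::{real_inner, complete_space} \<Rightarrow> real"
  assumes "bounded_linear f"
  shows "\<exists>z. \<forall>h. f h = inner h z"
proof -
  interpret f: bounded_linear f by fact
  define J where "J x = (norm x)\<^sup>2 / 2 - f x" for x
  define m where "m = Inf (range J)"
  obtain K where K: "\<And>x. norm (f x) \<le> norm x * K" using f.bounded by blast
  have "J x \<ge> - (K\<^sup>2 / 2)" for x
  proof -
    \<comment> \<open>Completing the square: \<open>J x\<close> is at least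
      \<open>((norm x - K)\<^sup>2 - K\<^sup>2) / 2\<close>.\<close>
    have "0 \<le> (norm x - K)\<^sup>2" by simp
    moreover have "f x \<le> norm x * K" using K[of x] by simp
    ultimately show ?thesis by (simp add: J_def power2_diff)
  qed
  then have "bdd_below (range J)" by (intro bdd_belowI2)
  then have m_le: "m \<le> J x" for x unfolding m_def by (rule cINF_lower) simp
  have "\<exists>x. J x < m + 1 / real (Suc n)" for n
  proof -
    have "Inf (range J) < m + 1 / real (Suc n)" by (simp add: m_def)
    from cInf_lessD[OF _ this] show ?thesis by auto
  qed
  then obtain u where u: "\<And>n. J (u n) < m + 1 / real (Suc n)" by metis
  \<comment> \<open>The linear part \<open>f\<close> drops out of the parallelogram identity. Since
    the midpoint has value at least \<open>m\<close>, two points with values near \<open>m\<close>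
    must be close together.\<close>
  have gap: "(norm (x - y))\<^sup>2 \<le> 4 * (J x - m) + 4 * (J y - m)" for x y
  proof -
    have "J ((1/2) *\<^sub>R (x + y)) = (J x + J y) / 2 - (norm (x - y))\<^sup>2 / 8"
      unfolding J_def power2_norm_eq_inner f.scaleR f.add
      by (simp add: inner_simps inner_commute field_simps)
    with m_le[of "(1/2) *\<^sub>R (x + y)"] show ?thesis by (simp add: field_simps)
  qed
  have "Cauchy u"
  proof (rule metric_CauchyI)
    fix e :: real assume "e > 0"
    \<comment> \<open>The threshold is chosen so that the two excesses, each multiplied by 4 in
      \<open>gap\<close>, add up to \<open>e\<^sup>2\<close>.\<close>
    then obtain N where N: "1 / real (Suc N) < e\<^sup>2 / 8"
      using nat_approx_posE[of "e\<^sup>2 / 8"] by auto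
    have close: "J (u n) - m < e\<^sup>2 / 8" if "n \<ge> N" for n
    proof -
      have "1 / real (Suc n) \<le> 1 / real (Suc N)" using that by (intro divide_left_mono) auto
      then show ?thesis using u[of n] N by linarith
    qed
    have "dist (u n) (u k) < e" if "n \<ge> N" "k \<ge> N" for n k
    proof -
      note gap[of "u n" "u k"]
      also have "4 * (J (u n) - m) + 4 * (J (u k) - m) < 4 * (e\<^sup>2 / 8) + 4 * (e\<^sup>2 / 8)"
        by (intro add_strict_mono mult_strict_left_mono close that) simp_all
      finally have "(norm (u n - u k))\<^sup>2 < e\<^sup>2" by simp
      then show ?thesis using \<open>e > 0\<close> by (simp add: dist_norm power_less_imp_less_base)
    qed
    then show "\<exists>M. \<forall>n\<ge>M. \<forall>k\<ge>M. dist (u n) (u k) < e" by blast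
  qed
  then obtain z where z: "u \<longlonglongrightarrow> z" by (auto simp: Cauchy_convergent_iff convergent_def)
  have "(\<lambda>n. J (u n)) \<longlonglongrightarrow> J z"
    unfolding J_def by (intro tendsto_intros f.tendsto z) simp
  moreover have "(\<lambda>n. m + 1 / real (Suc n)) \<longlonglongrightarrow> m"
    using tendsto_add[OF tendsto_const LIMSEQ_inverse_real_of_nat, of m]
    by (simp add: inverse_eq_divide)
  ultimately have "J z \<le> m"
    by (rule LIMSEQ_le) (use u less_imp_le in blast)
  have "f h = inner h z" for h
  proof -
    \<comment> \<open>\<open>a\<close> is the directional derivative of \<open>J\<close> at the
      minimiser \<open>z\<close> along \<open>h\<close>, hence must vanish.\<close>
    define a where "a = inner h z - f h"
    have quad: "0 \<le> t * a + t\<^sup>2 * (norm h)\<^sup>2 / 2" for t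
    proof -
      have "J (z + t *\<^sub>R h) = J z + t * a + t\<^sup>2 * (norm h)\<^sup>2 / 2"
        unfolding J_def a_def power2_norm_eq_inner f.scaleR f.add
        by (simp add: inner_simps inner_commute field_simps power2_eq_square)
      with \<open>J z \<le> m\<close> m_le[of "z + t *\<^sub>R h"] show ?thesis by simp
    qed
    \<comment> \<open>The added 1 keeps \<open>c\<close> positive when \<open>h = 0\<close>. As
      \<open>c\<close> exceeds half of \<open>(norm h)\<^sup>2\<close>, the step
      \<open>t = - a / c\<close> would make the quadratic negative unless
      \<open>a = 0\<close>.\<close>
    define c where "c = (norm h)\<^sup>2 + 1"
    have "c > 0" unfolding c_def by (simp add: add_nonneg_pos)
    have "a\<^sup>2 / c \<le> a\<^sup>2 * (norm h)\<^sup>2 / (2 * c\<^sup>2)"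
      using quad[of "- a / c"] by (simp add: power2_eq_square field_simps)
    then have "a\<^sup>2 * (2 * c) \<le> a\<^sup>2 * (norm h)\<^sup>2"
      using \<open>c > 0\<close> by (simp add: field_simps power2_eq_square)
    then have "a\<^sup>2 * (2 * c - (norm h)\<^sup>2) \<le> 0" by (simp add: algebra_simps)
    moreover have "2 * c - (norm h)\<^sup>2 > 0" unfolding c_def by (simp add: add_nonneg_pos)
    ultimately have "a\<^sup>2 \<le> 0" by (simp add: mult_le_0_iff)
    then show ?thesis by (simp add: a_def)
  qed
  then show ?thesis by blast
qed

text \<open>Uniqueness of representing vectors makes the choice linear, and evaluating
  \<open>f\<close> at its own representative bounds the norm. Boundedness is what lets
  \<open>R\<close> pass through Frechet derivatives.\<close>

lemma riesz_bounded_linear: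
  "\<exists>R :: ('a::{real_inner, complete_space} \<Rightarrow>\<^sub>L real) \<Rightarrow> 'a.
     bounded_linear R \<and> (\<forall>f h. blinfun_apply f h = inner h (R f))"
proof -
  have "\<forall>f :: 'a \<Rightarrow>\<^sub>L real. \<exists>z. \<forall>h. blinfun_apply f h = inner h z"
    using riesz_representation[OF blinfun.bounded_linear_right] by blast
  then obtain R :: "('a \<Rightarrow>\<^sub>L real) \<Rightarrow> 'a" where R: "\<And>f h. blinfun_apply f h = inner h (R f)"
    by metis
  have eqI: "u = v" if "\<And>h. inner h u = inner h v" for u v :: 'a
    using that[of "u - v"] by (metis inner_diff_right inner_eq_zero_iff right_minus_eq)
  have "bounded_linear R"
  proof (rule bounded_linear_intro[where K = 1])
    show "R (f + g) = R f + R g" for f g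
      by (rule eqI) (simp add: R[symmetric] inner_add_right blinfun.add_left)
    show "R (r *\<^sub>R f) = r *\<^sub>R R f" for r f
      by (rule eqI) (simp add: R[symmetric] blinfun.scaleR_left)
    show "norm (R f) \<le> norm f * 1" for f
    proof -
      have "norm (R f) * norm (R f) = blinfun_apply f (R f)"
        by (simp add: R dot_square_norm power2_eq_square)
      also have "\<dots> \<le> norm f * norm (R f)"
        using norm_blinfun[of f "R f"] by simp
      finally show ?thesis
        by (cases "R f = 0") auto
    qed
  qed
  with R show ?thesis by blast
qed

section \<open>Gradient and Hessian\<close>

text \<open>Repackaging the Hessian as a bounded linear map \<open>H x\<close> makes its continuity
  in the operator norm expressible; \<open>hessian\<close> itself yields plain functions.\<close>

lemma twice_continuously_differentiable_gradient:
  fixes \<Phi> :: "'a::{real_inner, complete_space} \<Rightarrow> real"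
  assumes "twice_continuously_differentiable \<Phi>"
  shows "\<exists>H :: 'a \<Rightarrow> 'a \<Rightarrow>\<^sub>L 'a. continuous_on UNIV H \<and>
    (\<forall>x. (gradient \<Phi> has_derivative blinfun_apply (H x)) (at x) \<and>
         hessian \<Phi> x = blinfun_apply (H x))"
proof -
  obtain D :: "'a \<Rightarrow> 'a \<Rightarrow>\<^sub>L real" and D2 :: "'a \<Rightarrow> 'a \<Rightarrow>\<^sub>L ('a \<Rightarrow>\<^sub>L real)" where
    D: "\<And>x. (\<Phi> has_derivative blinfun_apply (D x)) (at x)" and
    D2: "\<And>x. (D has_derivative blinfun_apply (D2 x)) (at x)" and
    cont: "continuous_on UNIV D2"
    using assms unfolding twice_continuously_differentiable_def by blast
  obtain R :: "('a \<Rightarrow>\<^sub>L real) \<Rightarrow> 'a" where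
    R: "bounded_linear R" "\<And>f h. blinfun_apply f h = inner h (R f)"
    using riesz_bounded_linear by blast
  \<comment> \<open>\<open>R\<close> is a fixed bounded linear map, so composing with it preserves
    both the derivative and the continuity of \<open>D2\<close>.\<close>
  define H where "H x = Blinfun R o\<^sub>L D2 x" for x
  have grad: "gradient \<Phi> = (\<lambda>x. R (D x))"
    by (intro ext gradient_eqI) (use D in \<open>simp add: gderiv_def R(2)[symmetric]\<close>)
  have deriv: "(gradient \<Phi> has_derivative blinfun_apply (H x)) (at x)" for x
    unfolding grad H_def
    using bounded_linear.has_derivative[OF R(1) D2[of x]]
    by (simp add: blinfun_compose.rep_eq bounded_linear_Blinfun_apply[OF R(1)] comp_def)
  moreover have "hessian \<Phi> x = blinfun_apply (H x)" for x
    unfolding hessian_def using frechet_derivative_at[OF deriv[of x]] by simp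
  moreover have "continuous_on UNIV H"
    unfolding H_def by (intro continuous_intros cont)
  ultimately show ?thesis by blast
qed

section \<open>Calculus of continuously differentiable curves\<close>

lemma continuously_differentiable_with_continuous:
  "continuously_differentiable_with x x' S \<Longrightarrow> continuous_on S x"
  unfolding continuously_differentiable_with_def
  by (metis continuous_on_eq_continuous_within has_vector_derivative_continuous)

text \<open>Chain rule; the derivative is continuous because applying a bounded linear map is
  jointly continuous in the map and its argument.\<close>

lemma continuously_differentiable_with_gradient:
  fixes \<Phi> :: "'a::{real_inner, complete_space} \<Rightarrow> real"
  assumes "twice_continuously_differentiable \<Phi>" and x: "continuously_differentiable_with x x' S"
  shows "continuously_differentiable_with
    (\<lambda>t. gradient \<Phi> (x t)) (\<lambda>t. hessian \<Phi> (x t) (x' t)) S"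
proof -
  obtain H :: "'a \<Rightarrow> 'a \<Rightarrow>\<^sub>L 'a" where H: "continuous_on UNIV H"
    "\<And>x. (gradient \<Phi> has_derivative blinfun_apply (H x)) (at x)"
    "\<And>x. hessian \<Phi> x = blinfun_apply (H x)"
    using twice_continuously_differentiable_gradient[OF assms(1)] by blast
  have "((\<lambda>t. gradient \<Phi> (x t)) has_vector_derivative H (x t) (x' t)) (at t within S)"
    if "t \<in> S" for t
    using vector_derivative_diff_chain_within[of x "x' t" t S, OF _ has_derivative_at_withinI[OF H(2)]]
      x that
    by (simp add: continuously_differentiable_with_def comp_def)
  moreover have "continuous_on S (\<lambda>t. H (x t) (x' t))"
  proof (intro continuous_intros)
    show "continuous_on S (\<lambda>t. H (x t))"
      using continuous_on_compose2[OF H(1) continuously_differentiable_with_continuous[OF x]]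
      by simp
    show "continuous_on S x'" using x by (simp add: continuously_differentiable_with_def)
  qed
  ultimately show ?thesis by (simp add: continuously_differentiable_with_def H(3))
qed

lemma continuously_differentiable_with_add:
  assumes "continuously_differentiable_with x x' S" "continuously_differentiable_with y y' S"
  shows "continuously_differentiable_with (\<lambda>t. x t + y t) (\<lambda>t. x' t + y' t) S"
  using assms unfolding continuously_differentiable_with_def
  by (auto intro!: derivative_intros continuous_intros)

lemma continuously_differentiable_with_scaleR:
  assumes x: "continuously_differentiable_with x x' S" and c: "continuously_differentiable_with c c' S"
  shows "continuously_differentiable_with
    (\<lambda>t. c t *\<^sub>R x t) (\<lambda>t. c t *\<^sub>R x' t + c' t *\<^sub>R x t) S"
  using assms continuously_differentiable_with_continuous[OF x]
    continuously_differentiable_with_continuous[OF c]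
  unfolding continuously_differentiable_with_def
  by (auto intro!: derivative_intros continuous_intros simp: has_real_derivative_iff_has_vector_derivative)

lemma continuously_differentiable_with_scaleR_const:
  assumes "continuously_differentiable_with x x' S"
  shows "continuously_differentiable_with (\<lambda>t. c *\<^sub>R x t) (\<lambda>t. c *\<^sub>R x' t) S"
  using assms unfolding continuously_differentiable_with_def
  by (auto intro!: derivative_eq_intros continuous_intros)

text \<open>Allows a curve or its derivative to be rewritten by differential equations that hold
  only for \<open>t \<ge> t0\<close>.\<close>

lemma continuously_differentiable_with_cong:
  assumes "continuously_differentiable_with x x' S"
    and "\<And>t. t \<in> S \<Longrightarrow> y t = x t" "\<And>t. t \<in> S \<Longrightarrow> y' t = x' t"
  shows "continuously_differentiable_with y y' S"
proof -
  have "continuous_on S y'"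
    using assms by (simp add: continuously_differentiable_with_def cong: continuous_on_cong)
  moreover have "(y has_vector_derivative y' t) (at t within S)" if "t \<in> S" for t
    using has_vector_derivative_transform[OF that, of y x "x' t"] assms that
    by (simp add: continuously_differentiable_with_def)
  ultimately show ?thesis by (simp add: continuously_differentiable_with_def)
qed

text \<open>Covers both coefficients of \<open>x\<close> to be differentiated,
  \<open>1 - \<beta> * \<alpha> / t\<close> and \<open>1 / \<beta> - \<alpha> / t\<close>.\<close>

lemma continuously_differentiable_with_const_minus_inverse:
  fixes a b t0 :: real
  assumes "t0 > 0"
  shows "continuously_differentiable_with (\<lambda>t. a - b / t) (\<lambda>t. b / t\<^sup>2) {t0..}"
  unfolding continuously_differentiable_with_def
    has_real_derivative_iff_has_vector_derivative[symmetric]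
  using assms
  by (auto intro!: derivative_eq_intros continuous_intros simp: power2_eq_square)

section \<open>Equivalence of the equation and the system\<close>

lemma second_order_imp_first_order:
  fixes \<Phi> :: "'a::{real_inner, complete_space} \<Rightarrow> real"
  assumes \<Phi>: "twice_continuously_differentiable \<Phi>" and \<beta>: "\<beta> \<noteq> 0" and t0: "t0 > 0"
    and sol: "second_order_solution \<Phi> \<alpha> \<beta> t0 x0 v0 x"
  shows "\<exists>y. first_order_solution \<Phi> \<alpha> \<beta> t0 x0
    (- \<beta> *\<^sub>R (v0 + \<beta> *\<^sub>R gradient \<Phi> x0) + (1 - \<beta> * \<alpha> / t0) *\<^sub>R x0) x y"
proof -
  obtain x' x'' where x: "continuously_differentiable_with x x' {t0..}"
    and x': "continuously_differentiable_with x' x'' {t0..}"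
    and ode: "\<And>t. t \<ge> t0 \<Longrightarrow>
      x'' t + (\<alpha> / t) *\<^sub>R x' t + \<beta> *\<^sub>R hessian \<Phi> (x t) (x' t) + gradient \<Phi> (x t) = 0"
    and init: "x t0 = x0" "x' t0 = v0"
    using sol unfolding second_order_solution_def by blast
  define y where "y t = - \<beta> *\<^sub>R (x' t + \<beta> *\<^sub>R gradient \<Phi> (x t)) + (1 - \<beta> * \<alpha> / t) *\<^sub>R x t" for t
  \<comment> \<open>Chosen so that the second equation holds by definition; what remains is that
    this is the derivative of \<open>y\<close>.\<close>
  define y' where "y' t = (1 / \<beta> - \<alpha> / t + \<alpha> * \<beta> / t\<^sup>2) *\<^sub>R x t - (1 / \<beta>) *\<^sub>R y t" for t
  have y_div: "(1 / \<beta>) *\<^sub>R y t = - (x' t + \<beta> *\<^sub>R gradient \<Phi> (x t)) + (1 / \<beta> - \<alpha> / t) *\<^sub>R x t" for t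
    using \<beta> by (simp add: y_def scaleR_add_right scaleR_diff_right diff_divide_distrib)
  have "continuously_differentiable_with y
     (\<lambda>t. - \<beta> *\<^sub>R (x'' t + \<beta> *\<^sub>R hessian \<Phi> (x t) (x' t)) +
       ((1 - \<beta> * \<alpha> / t) *\<^sub>R x' t + (\<beta> * \<alpha> / t\<^sup>2) *\<^sub>R x t)) {t0..}"
    unfolding y_def
    by (intro continuously_differentiable_with_add continuously_differentiable_with_scaleR
        continuously_differentiable_with_scaleR_const continuously_differentiable_with_gradient
        continuously_differentiable_with_const_minus_inverse \<Phi> x x' t0)
  then have "continuously_differentiable_with y y' {t0..}"
  proof (rule continuously_differentiable_with_cong)
    fix t assume "t \<in> {t0..}"
    then have "t \<ge> t0" by simp
    \<comment> \<open>The bracket on the right is the left-hand side of the second-order equation,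
      so it vanishes.\<close>
    have "x'' t + \<beta> *\<^sub>R hessian \<Phi> (x t) (x' t) =
        (x'' t + (\<alpha> / t) *\<^sub>R x' t + \<beta> *\<^sub>R hessian \<Phi> (x t) (x' t) + gradient \<Phi> (x t)) -
        (\<alpha> / t) *\<^sub>R x' t - gradient \<Phi> (x t)"
      by simp
    then have accel: "x'' t + \<beta> *\<^sub>R hessian \<Phi> (x t) (x' t) = - (\<alpha> / t) *\<^sub>R x' t - gradient \<Phi> (x t)"
      unfolding ode[OF \<open>t \<ge> t0\<close>] by simp
    \<comment> \<open>Both sides reduce to \<open>x' t + \<beta> *\<^sub>R gradient \<Phi> (x t) +
      (\<alpha> * \<beta> / t\<^sup>2) *\<^sub>R x t\<close>.\<close>
    show "y' t = - \<beta> *\<^sub>R (x'' t + \<beta> *\<^sub>R hessian \<Phi> (x t) (x' t)) +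
       ((1 - \<beta> * \<alpha> / t) *\<^sub>R x' t + (\<beta> * \<alpha> / t\<^sup>2) *\<^sub>R x t)"
      unfolding y'_def y_div accel by (simp add: algebra_simps)
  qed simp
  with x have "first_order_solution \<Phi> \<alpha> \<beta> t0 x0 (y t0) x y"
    unfolding first_order_solution_def
    by (intro exI[of _ x'] exI[of _ y']) (simp add: init y'_def y_div)
  then show ?thesis unfolding y_def init by blast
qed

text \<open>The system provides only one derivative of \<open>x\<close>. The second is gained from
  the first equation, which expresses \<open>x'\<close> through continuously differentiable
  functions.\<close>

lemma first_order_imp_second_order:
  fixes \<Phi> :: "'a::{real_inner, complete_space} \<Rightarrow> real"
  assumes \<Phi>: "twice_continuously_differentiable \<Phi>" and \<beta>: "\<beta> \<noteq> 0" and t0: "t0 > 0"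
    and sol: "first_order_solution \<Phi> \<alpha> \<beta> t0 x0
      (- \<beta> *\<^sub>R (v0 + \<beta> *\<^sub>R gradient \<Phi> x0) + (1 - \<beta> * \<alpha> / t0) *\<^sub>R x0) x y"
  shows "second_order_solution \<Phi> \<alpha> \<beta> t0 x0 v0 x"
proof -
  obtain x' y' where x: "continuously_differentiable_with x x' {t0..}"
    and y: "continuously_differentiable_with y y' {t0..}"
    and ode1: "\<And>t. t \<ge> t0 \<Longrightarrow>
      x' t + \<beta> *\<^sub>R gradient \<Phi> (x t) - (1 / \<beta> - \<alpha> / t) *\<^sub>R x t + (1 / \<beta>) *\<^sub>R y t = 0"
    and ode2: "\<And>t. t \<ge> t0 \<Longrightarrow>
      y' t - (1 / \<beta> - \<alpha> / t + \<alpha> * \<beta> / t\<^sup>2) *\<^sub>R x t + (1 / \<beta>) *\<^sub>R y t = 0"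
    and init: "x t0 = x0"
      "y t0 = - \<beta> *\<^sub>R (v0 + \<beta> *\<^sub>R gradient \<Phi> x0) + (1 - \<beta> * \<alpha> / t0) *\<^sub>R x0"
    using sol unfolding first_order_solution_def by blast
  have x'_eq: "x' t = (- \<beta>) *\<^sub>R gradient \<Phi> (x t) + (1 / \<beta> - \<alpha> / t) *\<^sub>R x t + (- (1 / \<beta>)) *\<^sub>R y t"
    if "t \<ge> t0" for t
    using ode1[OF that] by (simp add: algebra_simps add_eq_0_iff)
  \<comment> \<open>The termwise derivative of the right-hand side of \<open>x'_eq\<close>.\<close>
  define x'' where "x'' t = (- \<beta>) *\<^sub>R hessian \<Phi> (x t) (x' t) +
    ((1 / \<beta> - \<alpha> / t) *\<^sub>R x' t + (\<alpha> / t\<^sup>2) *\<^sub>R x t) + (- (1 / \<beta>)) *\<^sub>R y' t" for t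
  have "continuously_differentiable_with
    (\<lambda>t. (- \<beta>) *\<^sub>R gradient \<Phi> (x t) + (1 / \<beta> - \<alpha> / t) *\<^sub>R x t + (- (1 / \<beta>)) *\<^sub>R y t) x'' {t0..}"
    unfolding x''_def
    by (intro continuously_differentiable_with_add continuously_differentiable_with_scaleR
        continuously_differentiable_with_scaleR_const continuously_differentiable_with_gradient
        continuously_differentiable_with_const_minus_inverse \<Phi> x y t0)
  then have x': "continuously_differentiable_with x' x'' {t0..}"
    by (rule continuously_differentiable_with_cong) (simp_all add: x'_eq)
  have "x'' t + (\<alpha> / t) *\<^sub>R x' t + \<beta> *\<^sub>R hessian \<Phi> (x t) (x' t) + gradient \<Phi> (x t) = 0"
    if "t \<ge> t0" for t
  proof -
    \<comment> \<open>Subtracting the first equation from the second eliminates \<open>y\<close> and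
      leaves \<open>y'\<close> in terms of \<open>x\<close> and \<open>x'\<close>.\<close>
    have "y' t - (x' t + \<beta> *\<^sub>R gradient \<Phi> (x t) + (\<alpha> * \<beta> / t\<^sup>2) *\<^sub>R x t) =
        (y' t - (1 / \<beta> - \<alpha> / t + \<alpha> * \<beta> / t\<^sup>2) *\<^sub>R x t + (1 / \<beta>) *\<^sub>R y t) -
        (x' t + \<beta> *\<^sub>R gradient \<Phi> (x t) - (1 / \<beta> - \<alpha> / t) *\<^sub>R x t + (1 / \<beta>) *\<^sub>R y t)"
      by (simp add: algebra_simps)
    then have "y' t = x' t + \<beta> *\<^sub>R gradient \<Phi> (x t) + (\<alpha> * \<beta> / t\<^sup>2) *\<^sub>R x t"
      unfolding ode1[OF that] ode2[OF that] by simp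
    then have "(1 / \<beta>) *\<^sub>R y' t = (1 / \<beta>) *\<^sub>R x' t + gradient \<Phi> (x t) + (\<alpha> / t\<^sup>2) *\<^sub>R x t"
      using \<beta> by (simp add: scaleR_add_right)
    then show ?thesis unfolding x''_def by (simp add: algebra_simps)
  qed
  \<comment> \<open>The prescribed value of \<open>y t0\<close> is exactly the one for which the
    first equation at \<open>t0\<close> returns the velocity \<open>v0\<close>.\<close>
  moreover have "x' t0 = v0"
    using x'_eq[of t0] \<beta> by (simp add: init scaleR_add_right scaleR_diff_right scaleR_diff_left
        diff_divide_distrib)
  ultimately show ?thesis
    using x x' init(1) unfolding second_order_solution_def by blast
qed

theorem theorem4p1:
  fixes \<Phi> :: "'a::{real_inner, complete_space} \<Rightarrow> real"
    and \<alpha> \<beta> t0 :: real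
    and x0 v0 :: 'a
    and x :: "real \<Rightarrow> 'a"
  assumes "twice_continuously_differentiable \<Phi>"
    and "\<alpha> \<ge> 0" and "\<beta> > 0" and "t0 > 0"
  shows "second_order_solution \<Phi> \<alpha> \<beta> t0 x0 v0 x \<longleftrightarrow>
    (\<exists>y. first_order_solution \<Phi> \<alpha> \<beta> t0 x0
       (- \<beta> *\<^sub>R (v0 + \<beta> *\<^sub>R gradient \<Phi> x0) + (1 - \<beta> * \<alpha> / t0) *\<^sub>R x0) x y)"
  using second_order_imp_first_order[OF assms(1) _ assms(4)]
    first_order_imp_second_order[OF assms(1) _ assms(4)] assms(3)
  by (metis less_irrefl)

end
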